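(* Let $\delta\in(0,1/2)$ be fixed, and let $X$ and $L$ be as defined in the context. Suppose $(p_m,q_m)$, $m=1,2,\dots$, is a sequence of points in $\mathbb{R}^2$ and $\beta\in\mathbb{R}$ are such that for all $m$ $$X(p_m,q_m)=0,\qquad q_m\neq 0,\qquad \left|\frac{p_m}{q_m}\right|<1-\delta,$$ and $|q_m|\to\infty$, $\lim_{m\to\infty}\frac{p_m}{q_m}=\beta$. Then $$\frac{d^L}{dz^L}\left(\frac{z}{(1+z^2)^{3/2}}\right)\bigg|_{z=\beta}=0.$$
   Context: Let $M\ge1$, let $0<x_1<x_2<\cdots<x_M$ be real numbers and let $a_1,\dots,a_M$ be real numbers, not all zero. For $(x,y)\in\mathbb{R}^2\setminus\{(x_1,0),\dots,(x_M,0)\}$ let $$X(x,y)=\sum_{j=1}^M\frac{a_j(x-x_j)}{((x-x_j)^2+y^2)^{3/2}}.$$ Let $\mu_k=\sum_{j=1}^M a_jx_j^k$ for $k=0,1,\dots$. The integer $L$, $0\le L\le M-1$, is the unique integer such that $\mu_k=0$ for $k=0,1,\dots,L-1$ and $\mu_L\neq0$ (it exists by the non-vanishing of Vandermonde determinants). The $0$th derivative of a function is the function itself. *)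

theory Defs
  imports "HOL-Analysis.Analysis" "HOL-Computational_Algebra.Polynomial"
begin

text \<open>The meaningful domain of \<open>charge_field M a x\<close> is the plane without the points
  \<open>(x j, 0)\<close>, \<open>1 \<le> j \<le> M\<close>. At an excluded point the singular
  summand evaluates to \<open>0\<close> by the convention \<open>t / 0 = 0\<close>.\<close>

definition charge_field ::
  "nat \<Rightarrow> (nat \<Rightarrow> real) \<Rightarrow> (nat \<Rightarrow> real) \<Rightarrow> real \<Rightarrow> real \<Rightarrow> real" where
  "charge_field M a x u v =
     (\<Sum>j=1..M. a j * (u - x j) / ((u - x j)^2 + v^2) powr (3/2))"

definition moment :: "nat \<Rightarrow> (nat \<Rightarrow> real) \<Rightarrow> (nat \<Rightarrow> real) \<Rightarrow> nat \<Rightarrow> real" where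
  "moment M a x k = (\<Sum>j=1..M. a j * x j ^ k)"

definition first_moment_index :: "nat \<Rightarrow> (nat \<Rightarrow> real) \<Rightarrow> (nat \<Rightarrow> real) \<Rightarrow> nat" where
  "first_moment_index M a x =
     (THE L. L \<le> M - 1 \<and> (\<forall>k<L. moment M a x k = 0) \<and> moment M a x L \<noteq> 0)"

text \<open>The definite description in \<open>first_moment_index\<close> is meaningful for distinct
  \<open>x j\<close> and coefficients that are not all zero.\<close>

lemma ex1_first_moment_index:
  assumes inj: "inj_on x {1..M}" and nz: "\<exists>j\<in>{1..M}. a j \<noteq> 0"
  shows "\<exists>!L. L \<le> M - 1 \<and> (\<forall>k<L. moment M a x k = 0) \<and> moment M a x L \<noteq> 0"
proof -
  obtain i where i: "i \<in> {1..M}" "a i \<noteq> 0" using nz by blast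
  define P where "P = (\<Prod>j\<in>{1..M}-{i}. [:- x j, 1:])"
  have "degree P \<le> (\<Sum>j\<in>{1..M}-{i}. degree [:- x j, 1:])"
    unfolding P_def by (rule order_trans[OF degree_prod_sum_le]) auto
  then have deg: "degree P \<le> M - 1" using i by simp
  have P_poly: "poly P z = (\<Prod>j\<in>{1..M}-{i}. z - x j)" for z
    by (simp add: P_def poly_prod)
  have P_i: "poly P (x i) \<noteq> 0"
  proof -
    have "x i - x j \<noteq> 0" if "j \<in> {1..M} - {i}" for j
      using that i inj_onD[OF inj, of i j] by auto
    then show ?thesis unfolding P_poly by (simp only: prod_zero_iff finite_Diff finite_atLeastAtMost) blast
  qed
  have P_other: "poly P (x j) = 0" if "j \<in> {1..M}" "j \<noteq> i" for j
    unfolding P_poly using that by (intro prod_zero) auto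
  have "(\<Sum>k\<le>degree P. coeff P k * moment M a x k)
      = (\<Sum>j=1..M. a j * poly P (x j))"
  proof -
    have "(\<Sum>k\<le>degree P. coeff P k * moment M a x k)
        = (\<Sum>k\<le>degree P. \<Sum>j=1..M. a j * (coeff P k * x j ^ k))"
      unfolding moment_def sum_distrib_left by (intro sum.cong refl) (simp only: mult.left_commute)
    also have "\<dots> = (\<Sum>j=1..M. \<Sum>k\<le>degree P. a j * (coeff P k * x j ^ k))"
      by (rule sum.swap)
    also have "\<dots> = (\<Sum>j=1..M. a j * poly P (x j))"
      by (simp only: poly_altdef sum_distrib_left)
    finally show ?thesis .
  qed
  also have "\<dots> = (\<Sum>j=1..M. if j = i then a i * poly P (x i) else 0)"
    by (intro sum.cong) (auto simp: P_other)
  also have "\<dots> = a i * poly P (x i)" using i by simp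
  finally have "(\<Sum>k\<le>degree P. coeff P k * moment M a x k) \<noteq> 0"
    using i P_i by simp
  then obtain k where "k \<in> {..degree P}" "coeff P k * moment M a x k \<noteq> 0"
    by (rule sum.not_neutral_contains_not_neutral)
  then have k: "k \<le> degree P" "moment M a x k \<noteq> 0" by auto
  define L where "L = (LEAST k. moment M a x k \<noteq> 0)"
  have 1: "moment M a x L \<noteq> 0" unfolding L_def by (rule LeastI[of _ k]) (rule k(2))
  have 2: "\<forall>k<L. moment M a x k = 0" unfolding L_def using not_less_Least by blast
  have 3: "L \<le> M - 1"
    using Least_le[of "\<lambda>k. moment M a x k \<noteq> 0" k] k deg unfolding L_def by linarith
  show ?thesis
  proof (rule ex1I[of _ L])
    show "L \<le> M - 1 \<and> (\<forall>k<L. moment M a x k = 0) \<and> moment M a x L \<noteq> 0"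
      using 1 2 3 by blast
    fix L'
    assume L': "L' \<le> M - 1 \<and> (\<forall>k<L'. moment M a x k = 0) \<and> moment M a x L' \<noteq> 0"
    have "\<not> L < L'" using L' 1 by blast
    moreover have "\<not> L' < L" using L' 2 by blast
    ultimately show "L' = L" by simp
  qed
qed

end

theory Submission
  imports Defs
begin

text \<open>Write \<open>f z = z / (1 + z\<^sup>2) powr (3/2)\<close>. The field of a single charge is
  homogeneous of degree \<open>-2\<close>, so for \<open>v \<noteq> 0\<close> the field at \<open>(u, v)\<close> is a nonzero multiple of
  \<open>\<Sum>j. a j * f (u / v - x j * h)\<close> with \<open>h = 1 / v\<close> (\<open>charge_field_rescale\<close>). Far from the
  axis \<open>h\<close> is small, and the sum acts on \<open>f\<close> like a finite-difference operator: the Taylor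
  expansion of \<open>f\<close> at \<open>z = u / v\<close> has the coefficients \<open>moment M a x k * (-h) ^ k / k!\<close>
  in front of the \<open>k\<close>-th derivatives, so the first term to survive is the one of order
  \<open>L\<close>, the index of the first nonvanishing moment.

  A zero of the field makes the sum vanish. Expanding to order \<open>L\<close> with the Lagrange form of
  the remainder and cancelling \<open>(-h) ^ L / L!\<close> gives
  \<open>\<Sum>j. a j * x j ^ L * f\<^bsup>(L)\<^esup> (\<xi> j) = 0\<close> exactly, where \<open>\<xi> j\<close> lies within \<open>\<bar>x j * h\<bar>\<close> of
  \<open>z\<close>. Along the given sequence \<open>z \<longlonglongrightarrow> \<beta>\<close> and \<open>h \<longlonglongrightarrow> 0\<close>, so all \<open>\<xi> j\<close> tend to \<open>\<beta>\<close>, and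
  continuity of \<open>f\<^bsup>(L)\<^esup>\<close> yields \<open>moment M a x L * f\<^bsup>(L)\<^esup> \<beta> = 0\<close>
  (\<open>leading_moment_times_deriv_eq_0\<close>). The moment is nonzero, which is the claim.\<close>

text \<open>The functions \<open>p(z) (1 + z\<^sup>2)\<^sup>s\<close> with \<open>p\<close> a polynomial are closed under
  differentiation; this is what makes the field profile smooth without computing any of its
  higher derivatives.\<close>

lemma has_real_derivative_poly_mult_powr:
  fixes p :: "real poly" and s z :: real
  shows "((\<lambda>z. poly p z * (1 + z\<^sup>2) powr s) has_real_derivative
     poly (pderiv p * [:1, 0, 1:] + [:0, 2 * s:] * p) z * (1 + z\<^sup>2) powr (s - 1)) (at z)"
proof -
  have pos: "1 + z\<^sup>2 > 0" by (simp add: add_pos_nonneg)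
  have step: "(1 + z\<^sup>2) powr s = (1 + z\<^sup>2) * (1 + z\<^sup>2) powr (s - 1)"
    using pos by (simp add: powr_diff)
  have "((\<lambda>z. (1 + z\<^sup>2) powr s) has_real_derivative s * (1 + z\<^sup>2) powr (s - 1) * (2 * z)) (at z)"
    using pos by (auto intro!: derivative_eq_intros)
  then have "((\<lambda>z. poly p z * (1 + z\<^sup>2) powr s) has_real_derivative
      poly (pderiv p) z * (1 + z\<^sup>2) powr s + s * (1 + z\<^sup>2) powr (s - 1) * (2 * z) * poly p z) (at z)"
    by (rule DERIV_mult[OF poly_DERIV])
  then show ?thesis
    unfolding step by (simp add: algebra_simps power2_eq_square)
qed

lemma higher_deriv_poly_mult_powr:
  fixes p :: "real poly" and s :: real
  shows "\<exists>r t. (deriv ^^ n) (\<lambda>z. poly p z * (1 + z\<^sup>2) powr s) = (\<lambda>z. poly r z * (1 + z\<^sup>2) powr t)"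
proof (induction n)
  case 0
  show ?case by auto
next
  case (Suc n)
  then obtain r t where rt:
    "(deriv ^^ n) (\<lambda>z. poly p z * (1 + z\<^sup>2) powr s) = (\<lambda>z. poly r z * (1 + z\<^sup>2) powr t)" by blast
  have "(deriv ^^ Suc n) (\<lambda>z. poly p z * (1 + z\<^sup>2) powr s)
      = (\<lambda>z. poly (pderiv r * [:1, 0, 1:] + [:0, 2 * t:] * r) z * (1 + z\<^sup>2) powr (t - 1))"
    unfolding funpow.simps comp_apply rt
    by (rule ext) (rule DERIV_imp_deriv[OF has_real_derivative_poly_mult_powr])
  then show ?case by blast
qed

lemma has_real_derivative_higher_deriv_poly_mult_powr:
  fixes p :: "real poly" and s z :: real
  shows "((deriv ^^ n) (\<lambda>z. poly p z * (1 + z\<^sup>2) powr s) has_real_derivative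
     (deriv ^^ Suc n) (\<lambda>z. poly p z * (1 + z\<^sup>2) powr s) z) (at z)"
proof -
  obtain r t where
    rt: "(deriv ^^ n) (\<lambda>z. poly p z * (1 + z\<^sup>2) powr s) = (\<lambda>z. poly r z * (1 + z\<^sup>2) powr t)"
    using higher_deriv_poly_mult_powr by blast
  have "(deriv ^^ n) (\<lambda>z. poly p z * (1 + z\<^sup>2) powr s) field_differentiable at z"
    unfolding rt field_differentiable_def using has_real_derivative_poly_mult_powr by blast
  then show ?thesis
    by (simp add: DERIV_deriv_iff_field_differentiable)
qed

text \<open>The point is that \<open>u\<close> and \<open>v\<close> enter the sum only through the slope \<open>u / v\<close> and the
  step \<open>1 / v\<close>. Because the profile is odd, the same formula serves both half-planes: the
  sign of \<open>v\<close> is absorbed into the prefactor.\<close>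

lemma charge_field_rescale:
  assumes "v \<noteq> 0"
  shows "charge_field M a x u v = v / \<bar>v\<bar> ^ 3 *
    (\<Sum>j=1..M. a j * ((u / v - x j * (1 / v)) / (1 + (u / v - x j * (1 / v))\<^sup>2) powr (3/2)))"
proof -
  have "(u - x j) / ((u - x j)\<^sup>2 + v\<^sup>2) powr (3/2) = v / \<bar>v\<bar> ^ 3 *
      ((u / v - x j * (1 / v)) / (1 + (u / v - x j * (1 / v))\<^sup>2) powr (3/2))" for j
  proof -
    define w where "w = u / v - x j * (1 / v)"
    have w: "u - x j = v * w" using assms by (simp add: w_def field_simps)
    have "(v\<^sup>2) powr (3/2) = (\<bar>v\<bar> powr 2) powr (3/2)"
      using assms by simp
    also have "\<dots> = \<bar>v\<bar> ^ 3"
      using assms by (simp only: powr_powr) (simp flip: powr_numeral)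
    finally have v3: "(v\<^sup>2) powr (3/2) = \<bar>v\<bar> ^ 3" .
    have "(u - x j)\<^sup>2 + v\<^sup>2 = v\<^sup>2 * (1 + w\<^sup>2)"
      unfolding w by (simp add: algebra_simps power_mult_distrib)
    then have "((u - x j)\<^sup>2 + v\<^sup>2) powr (3/2) = \<bar>v\<bar> ^ 3 * (1 + w\<^sup>2) powr (3/2)"
      by (simp add: powr_mult v3)
    then show ?thesis
      unfolding w_def[symmetric] by (simp add: w)
  qed
  then show ?thesis
    unfolding charge_field_def sum_distrib_left
    by (intro sum.cong refl) (metis mult.left_commute times_divide_eq_right)
qed

text \<open>The Lagrange remainder, rather than an error term \<open>o(h\<^sup>L)\<close>, lets the factor \<open>h ^ L\<close> be
  cancelled exactly, so that a single passage to the limit remains.\<close>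

lemma leading_moment_times_deriv_eq_0:
  fixes f :: "real \<Rightarrow> real" and a x :: "'i \<Rightarrow> real" and z h :: "nat \<Rightarrow> real"
  assumes smooth: "\<And>n t. ((deriv ^^ n) f has_real_derivative (deriv ^^ Suc n) f t) (at t)"
    and vanish: "\<And>k. k < L \<Longrightarrow> (\<Sum>j\<in>J. a j * x j ^ k) = 0"
    and z: "z \<longlonglongrightarrow> \<beta>" and h: "h \<longlonglongrightarrow> 0"
    and zero: "\<forall>\<^sub>F m in sequentially. h m \<noteq> 0 \<and> (\<Sum>j\<in>J. a j * f (z m - x j * h m)) = 0"
  shows "(\<Sum>j\<in>J. a j * x j ^ L) * (deriv ^^ L) f \<beta> = 0"
proof -
  let ?D = "\<lambda>n. (deriv ^^ n) f"
  define lagrange_point where "lagrange_point m j \<xi> \<longleftrightarrow> \<bar>\<xi> - z m\<bar> \<le> \<bar>x j * h m\<bar> \<and>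
      f (z m - x j * h m) = (\<Sum>k<L. ?D k (z m) / fact k * (- (x j * h m)) ^ k)
        + ?D L \<xi> / fact L * (- (x j * h m)) ^ L" for m j \<xi>
  have "\<exists>\<xi>. lagrange_point m j \<xi>" for m j
  proof -
    have "\<forall>k t. ((\<lambda>s. ?D k (s + z m)) has_real_derivative ?D (Suc k) (t + z m)) (at t)"
      using smooth by (simp only: DERIV_shift[symmetric] simp_thms)
    from Maclaurin_all_le[OF _ this, of "\<lambda>s. f (s + z m)" "- (x j * h m)" L]
    obtain t where "\<bar>t\<bar> \<le> \<bar>x j * h m\<bar>"
      "f (z m - x j * h m) = (\<Sum>k<L. ?D k (z m) / fact k * (- (x j * h m)) ^ k)
        + ?D L (t + z m) / fact L * (- (x j * h m)) ^ L"
      by auto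
    then show ?thesis
      unfolding lagrange_point_def by (intro exI[of _ "t + z m"]) simp
  qed
  then obtain \<xi> where "\<And>m j. lagrange_point m j (\<xi> m j)"
    by metis
  then have near: "\<And>m j. \<bar>\<xi> m j - z m\<bar> \<le> \<bar>x j * h m\<bar>"
    and taylor: "\<And>m j. f (z m - x j * h m) =
      (\<Sum>k<L. ?D k (z m) / fact k * (- (x j * h m)) ^ k)
        + ?D L (\<xi> m j) / fact L * (- (x j * h m)) ^ L"
    unfolding lagrange_point_def by blast+
  have remainder: "(\<Sum>j\<in>J. a j * f (z m - x j * h m)) =
      (- h m) ^ L / fact L * (\<Sum>j\<in>J. a j * x j ^ L * ?D L (\<xi> m j))" for m
  proof -
    have pow: "(- (x j * h m)) ^ k = x j ^ k * (- h m) ^ k" for j k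
      by (simp flip: power_mult_distrib)
    have "(\<Sum>j\<in>J. a j * (\<Sum>k<L. ?D k (z m) / fact k * (- (x j * h m)) ^ k))
        = (\<Sum>k<L. ?D k (z m) / fact k * (- h m) ^ k * (\<Sum>j\<in>J. a j * x j ^ k))"
      unfolding sum_distrib_left pow
      by (subst sum.swap) (intro sum.cong refl, simp only: mult_ac)
    also have "\<dots> = 0" by (simp add: vanish)
    finally have lower: "(\<Sum>j\<in>J. a j * (\<Sum>k<L. ?D k (z m) / fact k * (- (x j * h m)) ^ k)) = 0" .
    have "(\<Sum>j\<in>J. a j * (?D L (\<xi> m j) / fact L * (- (x j * h m)) ^ L))
        = (- h m) ^ L / fact L * (\<Sum>j\<in>J. a j * x j ^ L * ?D L (\<xi> m j))"
      unfolding sum_distrib_left pow by (intro sum.cong refl) simp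
    then show ?thesis
      unfolding taylor distrib_left sum.distrib lower by simp
  qed
  have xi_tendsto: "(\<lambda>m. \<xi> m j) \<longlonglongrightarrow> \<beta>" for j
  proof -
    have "(\<lambda>m. \<bar>x j * h m\<bar>) \<longlonglongrightarrow> 0"
      using tendsto_mult_right_zero[OF h] by (rule tendsto_rabs_zero)
    then have "(\<lambda>m. \<xi> m j - z m) \<longlonglongrightarrow> 0"
      by (rule Lim_null_comparison[rotated]) (simp add: near)
    from tendsto_add[OF this z] show ?thesis by simp
  qed
  have "isCont (?D L) \<beta>" using smooth by (rule DERIV_isCont)
  then have "(\<lambda>m. \<Sum>j\<in>J. a j * x j ^ L * ?D L (\<xi> m j)) \<longlonglongrightarrow> (\<Sum>j\<in>J. a j * x j ^ L * ?D L \<beta>)"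
    by (intro tendsto_intros isCont_tendsto_compose[OF _ xi_tendsto])
  moreover have "\<forall>\<^sub>F m in sequentially. (\<Sum>j\<in>J. a j * x j ^ L * ?D L (\<xi> m j)) = 0"
    using zero by eventually_elim (auto simp: remainder)
  then have "(\<lambda>m. \<Sum>j\<in>J. a j * x j ^ L * ?D L (\<xi> m j)) \<longlonglongrightarrow> 0"
    by (rule tendsto_eventually)
  ultimately have "(\<Sum>j\<in>J. a j * x j ^ L * ?D L \<beta>) = 0"
    by (rule LIMSEQ_unique)
  then show ?thesis by (simp add: sum_distrib_right)
qed

theorem proposition2p6:
  fixes M :: nat and a x :: "nat \<Rightarrow> real"
    and p q :: "nat \<Rightarrow> real" and \<beta> \<delta> :: real
  assumes "M \<ge> 1"
    and "0 < x 1" and "strict_mono_on {1..M} x"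
    and "\<exists>j\<in>{1..M}. a j \<noteq> 0"
    and "0 < \<delta>" and "\<delta> < 1/2"
    and "\<And>m. m \<ge> 1 \<Longrightarrow> charge_field M a x (p m) (q m) = 0"
    and "\<And>m. m \<ge> 1 \<Longrightarrow> q m \<noteq> 0"
    and "\<And>m. m \<ge> 1 \<Longrightarrow> \<bar>p m / q m\<bar> < 1 - \<delta>"
    and "filterlim (\<lambda>m. \<bar>q m\<bar>) at_top sequentially"
    and "(\<lambda>m. p m / q m) \<longlonglongrightarrow> \<beta>"
  shows "(deriv ^^ first_moment_index M a x) (\<lambda>z::real. z / (1 + z^2) powr (3/2)) \<beta> = 0"
proof -
  let ?f = "\<lambda>z::real. z / (1 + z^2) powr (3/2)"
  let ?L = "first_moment_index M a x"
  have "inj_on x {1..M}"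
    using \<open>strict_mono_on {1..M} x\<close> by (rule strict_mono_on_imp_inj_on)
  from theI'[OF ex1_first_moment_index[OF this \<open>\<exists>j\<in>{1..M}. a j \<noteq> 0\<close>]]
  have lower: "\<And>k. k < ?L \<Longrightarrow> moment M a x k = 0" and leading: "moment M a x ?L \<noteq> 0"
    unfolding first_moment_index_def by blast+
  have f_eq: "?f = (\<lambda>z. poly [:0, 1:] z * (1 + z\<^sup>2) powr (-(3/2)))"
    by (simp add: fun_eq_iff powr_minus_divide)
  have smooth: "((deriv ^^ n) ?f has_real_derivative (deriv ^^ Suc n) ?f t) (at t)" for n t
    unfolding f_eq by (rule has_real_derivative_higher_deriv_poly_mult_powr)
  have "(\<lambda>m. inverse \<bar>q m\<bar>) \<longlonglongrightarrow> 0"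
    using assms(10) by (rule tendsto_inverse_0_at_top)
  then have h: "(\<lambda>m. 1 / q m) \<longlonglongrightarrow> 0"
    by (subst tendsto_rabs_zero_iff[symmetric]) (simp add: inverse_eq_divide)
  have zeros: "\<forall>\<^sub>F m in sequentially. 1 / q m \<noteq> 0 \<and>
      (\<Sum>j=1..M. a j * ?f (p m / q m - x j * (1 / q m))) = 0"
    using eventually_ge_at_top[of 1]
  proof eventually_elim
    case (elim m)
    then have "q m \<noteq> 0" and "charge_field M a x (p m) (q m) = 0"
      by (rule assms(8), rule assms(7))
    then show ?case by (simp add: charge_field_rescale)
  qed
  have "(\<Sum>j=1..M. a j * x j ^ ?L) * (deriv ^^ ?L) ?f \<beta> = 0"
    using lower by (intro leading_moment_times_deriv_eq_0[OF smooth _ assms(11) h zeros])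
      (simp add: moment_def)
  then show ?thesis
    using leading by (simp add: moment_def)
qed

end
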